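(* Let $h$ be a height function on $G_{m,n}$. If $h$ has a unique strict local maximum $q$, then $h(v) = h(q) - d(q,v)$ for every vertex $v$ of $G_{m,n}$. Dually, if $h$ has a unique strict local minimum $p$, then $h(v) = h(p) + d(p,v)$ for every vertex $v$.
   Context: $G_{m,n}$ is the grid graph with vertex set $\{(i,j): 1\le i\le m,\ 1\le j\le n\}$, each vertex joined to its horizontal and vertical neighbours; $d$ is its graph distance, $d((i_1,j_1),(i_2,j_2))=|i_1-i_2|+|j_1-j_2|$. A height function is a function $h:V(G_{m,n})\to\mathbb{Z}$ with $|h(u)-h(v)|=1$ for every edge $uv$. A vertex $v$ is a strict local maximum of $h$ if every neighbour $u$ satisfies $h(u)=h(v)-1$, and a strict local minimum if every neighbour $u$ satisfies $h(u)=h(v)+1$. *)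

theory Defs
  imports Main
begin

(* Graphs are given by a vertex set V and a set E of ordered pairs; an undirected edge uv
   is present in E in both orientations. *)

definition grid_verts :: "nat \<Rightarrow> nat \<Rightarrow> (nat \<times> nat) set" where
  "grid_verts m n = {1..m} \<times> {1..n}"

definition grid_edges :: "nat \<Rightarrow> nat \<Rightarrow> ((nat \<times> nat) \<times> (nat \<times> nat)) set" where
  "grid_edges m n = {((i, j), (i', j')) | i j i' j'.
     (i, j) \<in> grid_verts m n \<and> (i', j') \<in> grid_verts m n \<and>
     (i = i' \<and> (j' = j + 1 \<or> j = j' + 1) \<or> j = j' \<and> (i' = i + 1 \<or> i = i' + 1))}"

(* (u, v) is in E ^^ k iff there is a walk of length k from u to v. The value is
   meaningful only if v is reachable from u, which always holds in a grid. *)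
definition graph_dist :: "('a \<times> 'a) set \<Rightarrow> 'a \<Rightarrow> 'a \<Rightarrow> nat" where
  "graph_dist E u v = (LEAST k. (u, v) \<in> E ^^ k)"

abbreviation grid_dist :: "nat \<Rightarrow> nat \<Rightarrow> nat \<times> nat \<Rightarrow> nat \<times> nat \<Rightarrow> nat" where
  "grid_dist m n \<equiv> graph_dist (grid_edges m n)"

(* Functions on the vertex set are total functions whose values outside it are irrelevant. *)
definition height_function :: "nat \<Rightarrow> nat \<Rightarrow> (nat \<times> nat \<Rightarrow> int) \<Rightarrow> bool" where
  "height_function m n h \<longleftrightarrow> (\<forall>(u, v) \<in> grid_edges m n. \<bar>h u - h v\<bar> = 1)"

definition strict_local_max :: "nat \<Rightarrow> nat \<Rightarrow> (nat \<times> nat \<Rightarrow> int) \<Rightarrow> nat \<times> nat \<Rightarrow> bool" where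
  "strict_local_max m n h v \<longleftrightarrow>
     v \<in> grid_verts m n \<and> (\<forall>u. (v, u) \<in> grid_edges m n \<longrightarrow> h u = h v - 1)"

definition strict_local_min :: "nat \<Rightarrow> nat \<Rightarrow> (nat \<times> nat \<Rightarrow> int) \<Rightarrow> nat \<times> nat \<Rightarrow> bool" where
  "strict_local_min m n h v \<longleftrightarrow>
     v \<in> grid_verts m n \<and> (\<forall>u. (v, u) \<in> grid_edges m n \<longrightarrow> h u = h v + 1)"

lemma grid_walk_length_ge:
  "(u, v) \<in> grid_edges m n ^^ k \<Longrightarrow>
     \<bar>int (fst u) - int (fst v)\<bar> + \<bar>int (snd u) - int (snd v)\<bar> \<le> int k"
proof (induction k arbitrary: v)
  case (Suc k)
  then obtain w where w: "(u, w) \<in> grid_edges m n ^^ k" "(w, v) \<in> grid_edges m n" by auto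
  show ?case using Suc.IH[OF w(1)] w(2) by (auto simp: grid_edges_def)
qed simp

lemma grid_walk_exists:
  assumes "u \<in> grid_verts m n" "v \<in> grid_verts m n"
    and "int k = \<bar>int (fst u) - int (fst v)\<bar> + \<bar>int (snd u) - int (snd v)\<bar>"
  shows "(u, v) \<in> grid_edges m n ^^ k"
  using assms
proof (induction k arbitrary: v)
  case 0
  then show ?case by (auto simp: prod_eq_iff)
next
  case (Suc k)
  obtain a b i j where uv: "u = (a, b)" "v = (i, j)" by fastforce
  define w where "w = (if i < a then (i + 1, j) else if a < i then (i - 1, j)
    else if j < b then (i, j + 1) else (i, j - 1))"
  have "(w, v) \<in> grid_edges m n" "w \<in> grid_verts m n"
    "int k = \<bar>int (fst u) - int (fst w)\<bar> + \<bar>int (snd u) - int (snd w)\<bar>"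
    using Suc.prems unfolding uv w_def grid_edges_def grid_verts_def
    by (auto split: if_splits)
  then show ?case using Suc.IH[of w] Suc.prems(1) by auto
qed

lemma grid_dist_eq:
  assumes "u \<in> grid_verts m n" "v \<in> grid_verts m n"
  shows "int (grid_dist m n u v) = \<bar>int (fst u) - int (fst v)\<bar> + \<bar>int (snd u) - int (snd v)\<bar>"
proof -
  define k where "k = nat (\<bar>int (fst u) - int (fst v)\<bar> + \<bar>int (snd u) - int (snd v)\<bar>)"
  have k: "int k = \<bar>int (fst u) - int (fst v)\<bar> + \<bar>int (snd u) - int (snd v)\<bar>"
    by (simp add: k_def)
  have "grid_dist m n u v = k"
    unfolding graph_dist_def
  proof (rule Least_equality)
    show "(u, v) \<in> grid_edges m n ^^ k" using grid_walk_exists[OF assms k] .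
  next
    fix l assume "(u, v) \<in> grid_edges m n ^^ l"
    from grid_walk_length_ge[OF this] show "k \<le> l" using k by linarith
  qed
  then show ?thesis using k by simp
qed

end

theory Submission
  imports Defs
begin

text \<open>
  From a vertex that is not the unique strict local maximum one can step to a neighbour of
  larger height. Such an ascent must end at the maximum \<open>q\<close>, so every vertex \<open>v\<close> is joined to
  \<open>q\<close> by a walk of length \<open>h q - h v\<close>. Conversely heights change by at most one per step,
  so no walk from \<open>q\<close> to \<open>v\<close> is shorter. Minima of \<open>h\<close> are maxima of \<open>- h\<close>.
\<close>

lemma finite_grid_verts: "finite (grid_verts m n)"
  by (simp add: grid_verts_def)

lemma grid_edges_sym: "(u, v) \<in> grid_edges m n \<Longrightarrow> (v, u) \<in> grid_edges m n"
  by (auto simp: grid_edges_def)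

lemma grid_edges_verts: "(u, v) \<in> grid_edges m n \<Longrightarrow> v \<in> grid_verts m n"
  by (auto simp: grid_edges_def)

lemma height_function_edge:
  "height_function m n h \<Longrightarrow> (u, v) \<in> grid_edges m n \<Longrightarrow> \<bar>h u - h v\<bar> = 1"
  by (auto simp: height_function_def)

text \<open>Telescoping along the walk bounds the height difference by its length. This is the lower
  bound on the distance from \<open>q\<close>.\<close>

lemma height_function_walk:
  assumes "height_function m n h" and "(u, v) \<in> grid_edges m n ^^ k"
  shows "\<bar>h u - h v\<bar> \<le> int k"
  using assms(2)
proof (induction k arbitrary: v)
  case (Suc k)
  then obtain w where w: "(u, w) \<in> grid_edges m n ^^ k" "(w, v) \<in> grid_edges m n" by auto
  show ?case
    using Suc.IH[OF w(1)] height_function_edge[OF assms(1) w(2)] by simp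
qed simp

text \<open>Some neighbour fails to be one lower, and heights of neighbours differ by exactly one,
  so it is one higher. The edge points towards \<open>v\<close> so that it can extend a walk from
  \<open>q\<close> at its end.\<close>

lemma height_function_ascend:
  assumes "height_function m n h" and "v \<in> grid_verts m n" and "\<not> strict_local_max m n h v"
  obtains u where "(u, v) \<in> grid_edges m n" and "h u = h v + 1"
proof -
  obtain u where u: "(v, u) \<in> grid_edges m n" "h u \<noteq> h v - 1"
    using assms(2,3) by (auto simp: strict_local_max_def)
  have "h u = h v + 1"
    using height_function_edge[OF assms(1) u(1)] u(2) by linarith
  then show thesis
    using that[OF grid_edges_sym[OF u(1)]] by blast
qed

lemma walk_from_unique_max:
  assumes h: "height_function m n h" and q: "{x. strict_local_max m n h x} = {q}"
    and "v \<in> grid_verts m n"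
  shows "\<exists>k. (q, v) \<in> grid_edges m n ^^ k \<and> int k = h q - h v"
  using assms(3)
\<comment> \<open>The measure is the gap to the largest height on the grid: that \<open>h q\<close>
  attains it is not yet known.\<close>
proof (induction "nat (Max (h ` grid_verts m n) - h v)" arbitrary: v rule: less_induct)
  case less
  show ?case
  proof (cases "v = q")
    case True
    then show ?thesis by (intro exI[of _ 0]) simp
  next
    case False
    then have "\<not> strict_local_max m n h v" using q by blast
    then obtain u where u: "(u, v) \<in> grid_edges m n" "h u = h v + 1"
      using height_function_ascend[OF h less.prems] by blast
    have uV: "u \<in> grid_verts m n"
      using grid_edges_verts[OF grid_edges_sym[OF u(1)]] .
    \<comment> \<open>This bound makes the gap at \<open>v\<close> positive, so truncation by
      \<open>nat\<close> does not spoil the strict decrease.\<close>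
    then have "h u \<le> Max (h ` grid_verts m n)"
      by (simp add: finite_grid_verts)
    then have "nat (Max (h ` grid_verts m n) - h u) < nat (Max (h ` grid_verts m n) - h v)"
      using u(2) by linarith
    from less.hyps[OF this uV] obtain k where
      k: "(q, u) \<in> grid_edges m n ^^ k" "int k = h q - h u" by blast
    have "(q, v) \<in> grid_edges m n ^^ Suc k" using k(1) u(1) by auto
    moreover have "int (Suc k) = h q - h v" using k(2) u(2) by simp
    ultimately show ?thesis by blast
  qed
qed

lemma unique_max_height:
  assumes h: "height_function m n h" and "{x. strict_local_max m n h x} = {q}"
    and "v \<in> grid_verts m n"
  shows "h v = h q - int (grid_dist m n q v)"
proof -
  obtain k where k: "(q, v) \<in> grid_edges m n ^^ k" "int k = h q - h v"
    using walk_from_unique_max[OF assms] by blast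
  have "grid_dist m n q v = k"
    unfolding graph_dist_def
  proof (rule Least_equality)
    show "(q, v) \<in> grid_edges m n ^^ k" by (rule k(1))
  next
    fix l assume "(q, v) \<in> grid_edges m n ^^ l"
    \<comment> \<open>Any walk has length \<open>l\<close> at least
      \<open>\<bar>h q - h v\<bar>\<close>, hence at least \<open>k\<close>.\<close>
    from height_function_walk[OF h this] k(2) show "k \<le> l" by linarith
  qed
  then show ?thesis using k(2) by simp
qed

lemma height_function_uminus:
  "height_function m n h \<Longrightarrow> height_function m n (\<lambda>x. - h x)"
  by (auto simp: height_function_def abs_minus_commute)

text \<open>Negation reverses the height comparison at each edge. As an equality of predicates this
  rewrites under the set comprehension expressing uniqueness.\<close>

lemma strict_local_max_uminus:
  "strict_local_max m n (\<lambda>x. - h x) = strict_local_min m n h"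
proof -
  have "- h u = - h v - 1 \<longleftrightarrow> h u = h v + 1" for u v by linarith
  then show ?thesis
    by (simp add: fun_eq_iff strict_local_max_def strict_local_min_def)
qed

theorem lemma2p2:
  fixes m n :: nat and h :: "nat \<times> nat \<Rightarrow> int"
  assumes "height_function m n h"
  shows "(\<forall>q. {x. strict_local_max m n h x} = {q} \<longrightarrow>
            (\<forall>v \<in> grid_verts m n. h v = h q - int (grid_dist m n q v))) \<and>
         (\<forall>p. {x. strict_local_min m n h x} = {p} \<longrightarrow>
            (\<forall>v \<in> grid_verts m n. h v = h p + int (grid_dist m n p v)))"
proof (intro conjI allI impI ballI)
  fix q v assume "{x. strict_local_max m n h x} = {q}" "v \<in> grid_verts m n"
  then show "h v = h q - int (grid_dist m n q v)"
    using unique_max_height[OF assms] by blast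
next
  fix p v assume "{x. strict_local_min m n h x} = {p}" "v \<in> grid_verts m n"
  then show "h v = h p + int (grid_dist m n p v)"
    \<comment> \<open>For \<open>- h\<close> the formula reads \<open>- h v = - h p - d\<close>,
      with \<open>d\<close> the distance from \<open>p\<close> to \<open>v\<close>; negate both
      sides.\<close>
    using unique_max_height[OF height_function_uminus[OF assms], of p v]
    by (simp add: strict_local_max_uminus)
qed

end
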